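(* Let $p\ge 2$ be an integer, let $f:\mathbb{E}\to\mathbb{R}$ be convex and $p$-times differentiable with a global minimizer $x^*$, and let $\nu\in[0,1]$ be such that $H_{f,p}(\nu)<+\infty$. Let $\alpha\in\{\nu,1\}$ ($\alpha=\nu$ if $\nu$ is known, $\alpha=1$ if $\nu$ is unknown), and let $\{x_t\}_{t=0}^T$ be generated by the Accelerated Tensor Method (Algorithm 3, described in the context) with parameters $\alpha$, $\theta\ge0$ and upper bound $M_\nu>0$ on the regularization coefficients. Then, for $t=2,\ldots,T$, $$f(x_t)-f(x^* )\le\frac{2^{3p-1}M_\nu\,(p+\alpha)^{p+\alpha-1}\,\|x_0-x^*\|^{p+\alpha}}{(p-1)!\,(t-1)^{p+\alpha}}.$$
   Context: $\mathbb{E}$ is a finite-dimensional real vector space with dual $\mathbb{E}^*$; $B:\mathbb{E}\to\mathbb{E}^*$ is a self-adjoint positive definite operator, $\|x\|=\langle Bx,x\rangle^{1/2}$ on $\mathbb{E}$ and $\|s\|_*=\langle s,B^{-1}s\rangle^{1/2}$ on $\mathbb{E}^*$. For symmetric $p$-linear forms the norm is $\|D^pf(x)-D^pf(y)\|=\max_{\|h\|\le1}|D^pf(x)[h]^p-D^pf(y)[h]^p|$. The Hölder constant is $$H_{f,p}(\nu)=\sup_{x\ne y}\frac{\|D^pf(x)-D^pf(y)\|}{\|x-y\|^\nu},\qquad 0\le\nu\le1.$$ $\Phi_{x,p}(y)=f(x)+\sum_{i=1}^p\frac1{i!}D^if(x)[y-x]^i$, and $\Omega^{(\alpha)}_{x,p,H}(y)=\Phi_{x,p}(y)+\frac{H}{p!}\|y-x\|^{p+\alpha}$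 for $H>0$, $\alpha\in[0,1]$. Accelerated Tensor Method (Algorithm 3). Given $x_0\in\mathbb{E}$, $\theta\ge0$, $\alpha$ and a constant $M_\nu>0$, set $v_0=x_0$, $A_0=0$, $\psi_0(x)=\frac1{p+\alpha}\|x-x_0\|^{p+\alpha}$. At each iteration $t\ge0$ find $0<M_t\le M_\nu$ and a point $x_t^+$ such that, with $a_t>0$ the solution of $$a_t^{p+\alpha}=\frac{1}{2^{3p-1}}\left[\frac{(p-1)!}{M_t}\right](A_t+a_t)^{p+\alpha-1},$$ $\gamma_t=\frac{a_t}{A_t+a_t}$ and $y_t=(1-\gamma_t)x_t+\gamma_tv_t$, one has $$\Omega^{(\alpha)}_{y_t,p,M_t}(x_t^+)\le f(y_t),\qquad\|\nabla\Omega^{(\alpha)}_{y_t,p,M_t}(x_t^+)\|_*\le\theta\|x_t^+-y_t\|^{p+\alpha-1},$$ $$\langle\nabla f(x_t^+),y_t-x_t^+\rangle\ge\frac14\left[\frac{(p-1)!}{M_t}\right]^{\frac1{p+\alpha-1}}\|\nabla f(x_t^+)\|_*^{\frac{p+\alpha}{p+\alpha-1}}.$$ Then set $x_{t+1}=x_t^+$, $A_{t+1}=A_t+a_t$, $\psi_{t+1}(x)=\psi_t(x)+a_t[f(x_{t+1})+\langle\nabla f(x_{t+1}),x-x_{t+1}\rangle]$ and $v_{t+1}=\arg\min_{x\in\mathbb{E}}\psi_{t+1}(x)$. *)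

theory Defs
  imports "HOL-Analysis.Analysis"
begin

text \<open>
  The space E is a type of class \<open>euclidean_space\<close>; its own inner product and norm only
  serve to provide the (norm-independent) notion of derivative.  The dual of E is the type
  \<open>'a \<Rightarrow>\<^sub>L real\<close> of linear functionals, with pairing \<open>blinfun_apply s x\<close>.
\<close>

definition self_adjoint_pos_def :: "('a::euclidean_space \<Rightarrow> ('a \<Rightarrow>\<^sub>L real)) \<Rightarrow> bool" where
  "self_adjoint_pos_def B \<longleftrightarrow>
     linear B \<and>
     (\<forall>x y. blinfun_apply (B x) y = blinfun_apply (B y) x) \<and>
     (\<forall>x. x \<noteq> 0 \<longrightarrow> blinfun_apply (B x) x > 0)"

definition primal_norm :: "('a::euclidean_space \<Rightarrow> ('a \<Rightarrow>\<^sub>L real)) \<Rightarrow> 'a \<Rightarrow> real" where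
  "primal_norm B x = sqrt (blinfun_apply (B x) x)"

definition dual_norm :: "('a::euclidean_space \<Rightarrow> ('a \<Rightarrow>\<^sub>L real)) \<Rightarrow> ('a \<Rightarrow>\<^sub>L real) \<Rightarrow> real" where
  "dual_norm B s = sqrt (blinfun_apply s (inv B s))"

definition gradient :: "('a::euclidean_space \<Rightarrow> real) \<Rightarrow> 'a \<Rightarrow> ('a \<Rightarrow>\<^sub>L real)" where
  "gradient g x = Blinfun (frechet_derivative g (at x))"

text \<open>
  \<open>deriv_form f [h\<^sub>1, \<dots>, h\<^sub>i] x\<close> is \<open>D\<^sup>if(x)[h\<^sub>1, \<dots>, h\<^sub>i]\<close>.  Since E is finite-dimensional, the
  map sending x to the i-linear form \<open>D\<^sup>if(x)\<close> is Frechet differentiable iff each of its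
  evaluations at fixed directions is, so \<open>times_differentiable\<close> is ordinary p-fold
  Frechet differentiability on the whole space.
\<close>

fun deriv_form :: "('a::euclidean_space \<Rightarrow> real) \<Rightarrow> 'a list \<Rightarrow> 'a \<Rightarrow> real" where
  "deriv_form f [] = f"
| "deriv_form f (h # hs) = (\<lambda>x. frechet_derivative (deriv_form f hs) (at x) h)"

definition times_differentiable :: "nat \<Rightarrow> ('a::euclidean_space \<Rightarrow> real) \<Rightarrow> bool" where
  "times_differentiable p f \<longleftrightarrow>
     (\<forall>hs x. length hs < p \<longrightarrow> deriv_form f hs differentiable (at x))"

definition deriv_pow :: "nat \<Rightarrow> ('a::euclidean_space \<Rightarrow> real) \<Rightarrow> 'a \<Rightarrow> 'a \<Rightarrow> real" where
  "deriv_pow i f x h = deriv_form f (replicate i h) x"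

text \<open>
  The maximum over the unit ball is rendered as a supremum; for p times differentiable f it is
  attained, as a continuous function (a homogeneous polynomial in h) is maximised over a compact set.
\<close>

definition deriv_dist ::
  "('a::euclidean_space \<Rightarrow> ('a \<Rightarrow>\<^sub>L real)) \<Rightarrow> nat \<Rightarrow> ('a \<Rightarrow> real) \<Rightarrow> 'a \<Rightarrow> 'a \<Rightarrow> real" where
  "deriv_dist B p f x y =
     (SUP h\<in>{h. primal_norm B h \<le> 1}. \<bar>deriv_pow p f x h - deriv_pow p f y h\<bar>)"

definition holder_const ::
  "('a::euclidean_space \<Rightarrow> ('a \<Rightarrow>\<^sub>L real)) \<Rightarrow> nat \<Rightarrow> ('a \<Rightarrow> real) \<Rightarrow> real \<Rightarrow> ereal" where
  "holder_const B p f \<nu> =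
     (SUP (x, y)\<in>{(x, y). x \<noteq> y}. ereal (deriv_dist B p f x y / primal_norm B (x - y) powr \<nu>))"

definition taylor_model :: "nat \<Rightarrow> ('a::euclidean_space \<Rightarrow> real) \<Rightarrow> 'a \<Rightarrow> 'a \<Rightarrow> real" where
  "taylor_model p f x y = f x + (\<Sum>i=1..p. 1 / fact i * deriv_pow i f x (y - x))"

definition reg_model ::
  "('a::euclidean_space \<Rightarrow> ('a \<Rightarrow>\<^sub>L real)) \<Rightarrow> nat \<Rightarrow> real \<Rightarrow> ('a \<Rightarrow> real) \<Rightarrow> real \<Rightarrow> 'a \<Rightarrow> 'a \<Rightarrow> real" where
  "reg_model B p \<alpha> f H x y =
     taylor_model p f x y + H / fact p * primal_norm B (y - x) powr (real p + \<alpha>)"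

text \<open>
  \<open>accelerated_tensor_method\<close> says that the given sequences are a run of \<open>T\<close> iterations
  (numbered \<open>0, \<dots>, T - 1\<close>) of the method, producing \<open>x 0, \<dots>, x T\<close>.  The method is not
  deterministic: the regularization coefficients \<open>M t\<close> and the points \<open>xp t\<close> may be any
  that pass the tests.
\<close>

definition accelerated_tensor_method ::
  "('a::euclidean_space \<Rightarrow> ('a \<Rightarrow>\<^sub>L real)) \<Rightarrow> nat \<Rightarrow> ('a \<Rightarrow> real) \<Rightarrow> real \<Rightarrow> real \<Rightarrow> real \<Rightarrow> 'a \<Rightarrow> nat \<Rightarrow>
   (nat \<Rightarrow> 'a) \<Rightarrow> (nat \<Rightarrow> 'a) \<Rightarrow> (nat \<Rightarrow> 'a) \<Rightarrow> (nat \<Rightarrow> 'a) \<Rightarrow>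
   (nat \<Rightarrow> real) \<Rightarrow> (nat \<Rightarrow> real) \<Rightarrow> (nat \<Rightarrow> real) \<Rightarrow> (nat \<Rightarrow> real) \<Rightarrow> (nat \<Rightarrow> 'a \<Rightarrow> real) \<Rightarrow> bool" where
  "accelerated_tensor_method B p f \<alpha> \<theta> M\<^sub>\<nu> x0 T x xp y v M a A \<gamma> \<psi> \<longleftrightarrow>
     x 0 = x0 \<and> v 0 = x0 \<and> A 0 = 0 \<and>
     \<psi> 0 = (\<lambda>z. 1 / (real p + \<alpha>) * primal_norm B (z - x0) powr (real p + \<alpha>)) \<and>
     (\<forall>t<T.
        0 < M t \<and> M t \<le> M\<^sub>\<nu> \<and>
        0 < a t \<and>
        a t powr (real p + \<alpha>) =
          1 / 2 ^ (3 * p - 1) * (fact (p - 1) / M t) * (A t + a t) powr (real p + \<alpha> - 1) \<and>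
        \<gamma> t = a t / (A t + a t) \<and>
        y t = (1 - \<gamma> t) *\<^sub>R x t + \<gamma> t *\<^sub>R v t \<and>
        reg_model B p \<alpha> f (M t) (y t) (xp t) \<le> f (y t) \<and>
        dual_norm B (gradient (reg_model B p \<alpha> f (M t) (y t)) (xp t))
          \<le> \<theta> * primal_norm B (xp t - y t) powr (real p + \<alpha> - 1) \<and>
        blinfun_apply (gradient f (xp t)) (y t - xp t)
          \<ge> 1 / 4 * (fact (p - 1) / M t) powr (1 / (real p + \<alpha> - 1))
              * dual_norm B (gradient f (xp t)) powr ((real p + \<alpha>) / (real p + \<alpha> - 1)) \<and>
        x (Suc t) = xp t \<and>
        A (Suc t) = A t + a t \<and>
        \<psi> (Suc t) =
          (\<lambda>z. \<psi> t z + a t * (f (x (Suc t))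
                 + blinfun_apply (gradient f (x (Suc t))) (z - x (Suc t)))) \<and>
        is_arg_min (\<psi> (Suc t)) (\<lambda>_. True) (v (Suc t)))"

end

theory Submission
  imports Defs
begin

text \<open>
  Put \<open>q = p + \<alpha>\<close>.  Estimate sequences: one shows
  \<open>A\<^sub>t f(x\<^sub>t) \<le> min \<psi>\<^sub>t \<le> A\<^sub>t f(x\<^sup>*) + \<parallel>x\<^sup>* - x\<^sub>0\<parallel>\<^sup>q / q\<close>.  In the induction step for the first
  inequality, the growth of \<open>\<psi>\<^sub>t\<close> away from its minimizer and the descent condition on
  \<open>\<nabla>f(x\<^bsub>t+1\<^esub>)\<close> together absorb the linear term \<open>a\<^sub>t \<langle>\<nabla>f(x\<^bsub>t+1\<^esub>), v\<^bsub>t+1\<^esub> - v\<^sub>t\<rangle>\<close> by Young's inequality.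
  Instead of uniform convexity of \<open>\<parallel>\<cdot>\<parallel>\<^sup>q\<close> with its sharp constant, Clarkson's inequality at the
  midpoint suffices: it loses a factor 2, which is recovered from \<open>(1 + 1/(q-1))\<^bsup>q-1\<^esup> \<ge> 2\<close>.
  Finally, the equation for \<open>a\<^sub>t\<close> makes \<open>A\<^sub>t\<^bsup>1/q\<^esup>\<close> grow at least linearly in \<open>t\<close>.
\<close>

section \<open>Inequalities for real powers, and the recurrence for \<open>A\<close>\<close>

lemma mult_powr_le_young:
  fixes u w q :: real
  assumes "q > 1" "u \<ge> 0" "w \<ge> 0"
  shows "u * w powr (q - 1) \<le> u powr q / q + (q - 1) / q * w powr q"
proof -
  have "u * w powr (q - 1) \<le> u powr q / q + (w powr (q - 1)) powr (q / (q - 1)) / (q / (q - 1))"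
    using assms by (intro Youngs_inequality) (auto simp: field_simps)
  also have "(w powr (q - 1)) powr (q / (q - 1)) = w powr q"
    using assms by (simp add: powr_powr)
  finally show ?thesis by (simp add: field_simps)
qed

text \<open>This is convexity of the power function, with the tangent taken at \<open>w\<close>.
  Deriving it from Young's inequality needs no derivative, so \<open>u = 0\<close> and
  \<open>w = 0\<close> are covered.\<close>

lemma powr_diff_le_tangent:
  fixes u w q :: real
  assumes "q > 1" "u \<ge> 0" "w \<ge> 0"
  shows "w powr q - u powr q \<le> q * w powr (q - 1) * (w - u)"
proof -
  have "w * w powr (q - 1) = w powr q"
    using assms by (cases "w = 0") (auto simp: powr_diff)
  moreover have "q * (u * w powr (q - 1)) \<le> u powr q + (q - 1) * w powr q"
    using mult_left_mono[OF mult_powr_le_young[OF assms], of q] assms(1)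
    by (simp add: distrib_left)
  ultimately show ?thesis by (simp add: algebra_simps)
qed

text \<open>Write each power as \<open>x * x powr (r - 1)\<close> and enlarge the second factor by
  monotonicity.\<close>

lemma powr_add_powr_le:
  fixes m n r :: real
  assumes "r \<ge> 1" "m \<ge> 0" "n \<ge> 0"
  shows "m powr r + n powr r \<le> (m + n) powr r"
proof -
  have split: "x powr r = x * x powr (r - 1)" if "x \<ge> 0" for x :: real
    using that by (cases "x = 0") (auto simp: powr_diff)
  have "m * m powr (r - 1) + n * n powr (r - 1)
      \<le> m * (m + n) powr (r - 1) + n * (m + n) powr (r - 1)"
    using assms by (intro add_mono mult_left_mono powr_mono2) auto
  then show ?thesis using assms by (simp add: split algebra_simps)
qed

text \<open>Add the two tangent inequalities at the midpoint: their linear terms cancel.\<close>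

lemma powr_midpoint_le:
  fixes m n r :: real
  assumes "r \<ge> 1" "m \<ge> 0" "n \<ge> 0"
  shows "((m + n) / 2) powr r \<le> (m powr r + n powr r) / 2"
proof (cases "r = 1")
  case True
  then show ?thesis using assms by simp
next
  case False
  with assms have r: "r > 1" by simp
  let ?w = "(m + n) / 2"
  have "?w powr r - m powr r \<le> r * ?w powr (r - 1) * (?w - m)"
    "?w powr r - n powr r \<le> r * ?w powr (r - 1) * (?w - n)"
    using assms r by (intro powr_diff_le_tangent; simp)+
  then show ?thesis by (simp add: field_simps)
qed

text \<open>Weighted AM-GM for 2 and 1 with weights \<open>1 / r\<close> and
  \<open>1 - 1 / r\<close>. With \<open>r = q - 1\<close> this pays for the factor lost by the
  midpoint argument.\<close>

lemma two_powr_le: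
  fixes r :: real
  assumes "r \<ge> 1"
  shows "2 powr (1 / r) \<le> (r + 1) / r"
  using Youngs_inequality_0[of "1 / r" "1 - 1 / r" 2 1] assms by (simp add: add_divide_distrib)

text \<open>Used with \<open>A\<close> as the updated weight, \<open>K = (p-1)! / M\<close>,
  \<open>G\<close> the dual norm of the gradient and \<open>r\<close> the distance between
  successive \<open>v\<close>. The right side is then what the descent condition and the growth of
  the estimate function supply.\<close>

lemma estimate_sequence_young:
  fixes q a A K G r :: real and p :: nat
  assumes q: "2 \<le> q" "q \<le> real p + 1"
    and nonneg: "0 \<le> a" "0 \<le> A" "0 \<le> K" "0 \<le> G" "0 \<le> r"
    and a: "a powr q = 1 / 2 ^ (3 * p - 1) * K * A powr (q - 1)"
  shows "a * (G * r) \<le> A * (1 / 4 * K powr (1 / (q - 1)) * G powr (q / (q - 1)))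
           + 2 / q * (r / 2) powr q"
proof -
  let ?e = "1 / (q - 1)"
  have p: "p \<ge> 1" using q by linarith
  have "(2::real) ^ (3 * p - 1) = 2 powr (3 * real p - 1)"
    using p by (simp flip: powr_realpow add: of_nat_diff)
  then have "(1 / 2 ^ (3 * p - 1)) powr ?e = 2 powr (- (3 * real p - 1) * ?e)"
    by (simp only: powr_divide powr_powr powr_one_eq_one powr_minus_divide mult_minus_left)
  also have "\<dots> \<le> 2 powr (?e - 3)"
  proof (rule powr_mono)
    \<comment> \<open>Equivalent to \<open>q \<le> p + 1\<close>; this is where the exponent
      \<open>3 * p - 1\<close> of the method enters.\<close>
    have "- (3 * real p - 1) * ?e \<le> (1 - 3 * (q - 1)) * ?e"
      using q by (intro mult_right_mono) auto
    also have "\<dots> = ?e - 3" using q by (simp add: field_simps)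
    finally show "- (3 * real p - 1) * ?e \<le> ?e - 3" .
  qed simp
  also have "\<dots> = 2 powr ?e / 8"
    by (simp add: powr_diff)
  also have "\<dots> \<le> (q / (q - 1)) / 8"
    by (rule divide_right_mono) (use two_powr_le[of "q - 1"] q in auto)
  finally have c: "(1 / 2 ^ (3 * p - 1)) powr ?e \<le> q / (q - 1) / 8" .
  have "a powr (q / (q - 1)) = (a powr q) powr ?e"
    by (simp add: powr_powr)
  also have "\<dots> = (1 / 2 ^ (3 * p - 1)) powr ?e * K powr ?e * A"
    using q nonneg unfolding a by (simp only: powr_mult) (simp add: powr_powr)
  also have "\<dots> \<le> q / (q - 1) / 8 * K powr ?e * A"
    using c nonneg by (intro mult_right_mono) auto
  finally have a_le: "a powr (q / (q - 1)) \<le> q / (q - 1) / 8 * K powr ?e * A" .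
  \<comment> \<open>The factor 2 of \<open>r = 2 * (r / 2)\<close> is split so that Young's
    inequality puts a coefficient 2 on both powers. The first gives
    \<open>2 / q * (r / 2) powr q\<close>; in the second, 2 times the 1/8 of \<open>a_le\<close>
    gives 1/4.\<close>
  let ?P = "2 powr ((q - 1) / q) * (a * G)" and ?Q = "2 powr (1 / q) * (r / 2)"
  have "2 powr ((q - 1) / q) * 2 powr (1 / q) = 2"
    using q by (simp flip: powr_add add: field_simps)
  then have "a * (G * r) = ?Q * ?P"
    by (simp add: algebra_simps)
  also have "\<dots> \<le> ?Q powr q / q + ?P powr (q / (q - 1)) / (q / (q - 1))"
    using q nonneg by (intro Youngs_inequality) (auto simp: field_simps)
  also have "?Q powr q = 2 * (r / 2) powr q"
    using q nonneg by (simp only: powr_mult) (simp add: powr_powr)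
  also have "?P powr (q / (q - 1)) = 2 * (a powr (q / (q - 1)) * G powr (q / (q - 1)))"
    using q nonneg by (simp add: powr_mult powr_powr)
  also have "2 * (a powr (q / (q - 1)) * G powr (q / (q - 1))) / (q / (q - 1))
      \<le> 2 * ((q / (q - 1) / 8 * K powr ?e * A) * G powr (q / (q - 1))) / (q / (q - 1))"
    using q by (intro divide_right_mono mult_left_mono mult_right_mono a_le) auto
  also have "\<dots> = A * (1 / 4 * K powr ?e * G powr (q / (q - 1)))"
    using q by (simp add: field_simps)
  finally show ?thesis by (simp add: algebra_simps)
qed

text \<open>For \<open>u\<close> and \<open>w\<close> the q-th roots of successive values, the
  recurrence and the tangent inequality bound \<open>w powr q - u powr q\<close> from both sides by
  multiples of \<open>w powr (q - 1)\<close>. Cancelling it, the root rises by at least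
  \<open>C powr (1 / q) / q\<close> per step.\<close>

lemma powr_growth:
  fixes A :: "nat \<Rightarrow> real" and q C :: real
  assumes q: "q > 1" and C: "C \<ge> 0"
    and A0: "A 0 = 0" and mono: "\<And>t. t < T \<Longrightarrow> A t < A (Suc t)"
    and step: "\<And>t. t < T \<Longrightarrow> C * A (Suc t) powr (q - 1) \<le> (A (Suc t) - A t) powr q"
    and "t \<le> T"
  shows "C * (real t / q) powr q \<le> A t"
proof -
  have root: "0 \<le> A t \<and> real t * C powr (1 / q) / q \<le> A t powr (1 / q)"
    using \<open>t \<le> T\<close>
  proof (induction t)
    case 0
    then show ?case using A0 by simp
  next
    case (Suc t)
    then have IH: "0 \<le> A t" "real t * C powr (1 / q) / q \<le> A t powr (1 / q)" and t: "t < T"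
      by auto
    let ?u = "A t powr (1 / q)" and ?w = "A (Suc t) powr (1 / q)"
    have less: "A t < A (Suc t)" using mono[OF t] .
    have pos: "0 < A (Suc t)" using less IH by simp
    have "C powr (1 / q) * ?w powr (q - 1) = (C * A (Suc t) powr (q - 1)) powr (1 / q)"
      using C pos by (simp add: powr_mult powr_powr mult.commute)
    also have "\<dots> \<le> ((A (Suc t) - A t) powr q) powr (1 / q)"
      using step[OF t] C q by (intro powr_mono2) auto
    also have "\<dots> = ?w powr q - ?u powr q"
      using less IH q by (simp add: powr_powr)
    also have "\<dots> \<le> q * ?w powr (q - 1) * (?w - ?u)"
      by (intro powr_diff_le_tangent q) auto
    finally have "C powr (1 / q) * ?w powr (q - 1) \<le> (q * (?w - ?u)) * ?w powr (q - 1)"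
      by (simp only: mult_ac)
    then have "C powr (1 / q) \<le> q * (?w - ?u)"
      by (rule mult_right_le_imp_le) (use pos in simp)
    then have "C powr (1 / q) / q \<le> ?w - ?u"
      using q by (simp add: field_simps)
    with IH pos show ?case by (simp add: distrib_right add_divide_distrib)
  qed
  have "C * (real t / q) powr q = (real t * C powr (1 / q) / q) powr q"
    using C q by (simp add: powr_mult powr_divide powr_powr)
  also have "\<dots> \<le> (A t powr (1 / q)) powr q"
    using root C q by (intro powr_mono2) auto
  also have "\<dots> = A t" using root q by (simp add: powr_powr)
  finally show ?thesis .
qed

section \<open>The primal and dual norms induced by \<open>B\<close>\<close>

lemma blinfun_linear_surj:
  fixes B :: "'a::euclidean_space \<Rightarrow> ('a \<Rightarrow>\<^sub>L real)"
  assumes "linear B" "inj B"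
  shows "surj B"
proof -
  \<comment> \<open>\<open>J\<close> identifies a functional with its coordinate vector. Thus
    \<open>J \<circ> B\<close> is an injective endomorphism of a finite-dimensional space, hence
    onto, and injectivity of \<open>J\<close> carries this back to \<open>B\<close>.\<close>
  define J :: "('a \<Rightarrow>\<^sub>L real) \<Rightarrow> 'a" where "J s = (\<Sum>b\<in>Basis. blinfun_apply s b *\<^sub>R b)" for s
  have J: "linear J"
    by (rule linearI) (simp_all add: J_def blinfun.bilinear_simps scaleR_left_distrib
        sum.distrib scaleR_sum_right)
  have apply_J: "J s \<bullet> b = blinfun_apply s b" if "b \<in> Basis" for s b
    using that by (simp add: J_def inner_sum_left inner_Basis if_distrib sum.delta cong: if_cong)
  have "inj J"
    by (metis apply_J blinfun_euclidean_eqI injI)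
  have "surj (J \<circ> B)"
    using linear_compose[OF assms(1) J] inj_compose[OF \<open>inj J\<close> assms(2)]
    by (rule linear_inj_imp_surj)
  show ?thesis unfolding surj_def
  proof
    fix s
    obtain u where "J s = J (B u)" using \<open>surj (J \<circ> B)\<close> by (metis comp_apply surjD)
    then show "\<exists>u. s = B u" using \<open>inj J\<close> by (auto dest: injD)
  qed
qed

context
  fixes B :: "'a::euclidean_space \<Rightarrow> ('a \<Rightarrow>\<^sub>L real)"
  assumes B: "self_adjoint_pos_def B"
begin

lemma form_nonneg: "0 \<le> blinfun_apply (B x) x"
  using B by (cases "x = 0") (auto simp: self_adjoint_pos_def_def less_imp_le)

lemma primal_norm_nonneg [simp]: "0 \<le> primal_norm B x"
  by (simp add: primal_norm_def form_nonneg)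

lemma primal_norm_sq: "(primal_norm B x)\<^sup>2 = blinfun_apply (B x) x"
  by (simp add: primal_norm_def form_nonneg)

lemma form_linear:
  "B (x + y) = B x + B y" "B (x - y) = B x - B y" "B (c *\<^sub>R x) = c *\<^sub>R B x" "B 0 = 0"
  using B by (simp_all add: self_adjoint_pos_def_def linear_add linear_diff linear_cmul linear_0)

lemma form_commute: "blinfun_apply (B x) y = blinfun_apply (B y) x"
  using B by (simp add: self_adjoint_pos_def_def)

lemma form_Cauchy_Schwarz:
  "\<bar>blinfun_apply (B x) y\<bar> \<le> primal_norm B x * primal_norm B y"
proof (cases "y = 0")
  case True
  then show ?thesis by (simp add: blinfun.zero_right)
next
  case False
  then have pos: "blinfun_apply (B y) y > 0"
    using B by (simp add: self_adjoint_pos_def_def)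
  \<comment> \<open>The projection coefficient: \<open>x - c *\<^sub>R y\<close> is orthogonal to
    \<open>y\<close> in the form of \<open>B\<close>.\<close>
  define c where "c = blinfun_apply (B x) y / blinfun_apply (B y) y"
  have c: "c * blinfun_apply (B y) y = blinfun_apply (B x) y"
    using pos by (simp add: c_def)
  have "0 \<le> blinfun_apply (B (x - c *\<^sub>R y)) (x - c *\<^sub>R y)"
    by (rule form_nonneg)
  also have "\<dots> = blinfun_apply (B x) x - c * blinfun_apply (B x) y
      - c * (blinfun_apply (B x) y - c * blinfun_apply (B y) y)"
    using form_commute[of y x]
    by (simp add: form_linear blinfun.bilinear_simps algebra_simps)
  finally have "c * blinfun_apply (B x) y \<le> blinfun_apply (B x) x"
    by (simp add: c)
  then have "(blinfun_apply (B x) y)\<^sup>2 \<le> (primal_norm B x * primal_norm B y)\<^sup>2"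
    using pos unfolding power_mult_distrib primal_norm_sq
    by (simp add: c_def power2_eq_square field_simps)
  then show ?thesis
    by (metis abs_le_square_iff abs_of_nonneg mult_nonneg_nonneg primal_norm_nonneg)
qed

text \<open>Surjectivity makes \<open>inv B\<close> in \<open>dual_norm\<close> a genuine right
  inverse of \<open>B\<close>.\<close>

lemma surj_form: "surj B"
proof (rule blinfun_linear_surj)
  show "linear B" using B by (simp add: self_adjoint_pos_def_def)
  show "inj B"
  proof (rule injI)
    fix x y assume "B x = B y"
    then have "blinfun_apply (B (x - y)) (x - y) = 0" by (simp add: form_linear)
    then show "x = y" using B unfolding self_adjoint_pos_def_def
      by (metis less_irrefl right_minus_eq)
  qed
qed

lemma dual_norm_eq: "dual_norm B s = primal_norm B (inv B s)"
  by (simp add: dual_norm_def primal_norm_def surj_f_inv_f[OF surj_form])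

lemma dual_pairing_ge: "- (dual_norm B s * primal_norm B h) \<le> blinfun_apply s h"
  using form_Cauchy_Schwarz[of "inv B s" h]
  by (simp add: dual_norm_eq surj_f_inv_f[OF surj_form] abs_le_iff)

text \<open>The parallelogram law handles squares. Since \<open>q / 2 \<ge> 1\<close>,
  superadditivity and then midpoint convexity of the power \<open>q / 2\<close> lift it to exponent
  \<open>q\<close>.\<close>

lemma primal_norm_powr_Clarkson:
  assumes q: "q \<ge> 2"
  shows "primal_norm B ((1/2) *\<^sub>R (x + y)) powr q + primal_norm B ((1/2) *\<^sub>R (x - y)) powr q
    \<le> (primal_norm B x powr q + primal_norm B y powr q) / 2"
proof -
  have sq: "primal_norm B z powr q = ((primal_norm B z)\<^sup>2) powr (q / 2)" for z
    by (simp add: powr_powr flip: powr_numeral)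
  have parallelogram: "(primal_norm B ((1/2) *\<^sub>R (x + y)))\<^sup>2 + (primal_norm B ((1/2) *\<^sub>R (x - y)))\<^sup>2
      = ((primal_norm B x)\<^sup>2 + (primal_norm B y)\<^sup>2) / 2"
    by (simp add: primal_norm_sq form_linear blinfun.bilinear_simps field_simps)
  show ?thesis
    unfolding sq
    using powr_add_powr_le[of "q / 2" "(primal_norm B ((1/2) *\<^sub>R (x + y)))\<^sup>2"
        "(primal_norm B ((1/2) *\<^sub>R (x - y)))\<^sup>2"]
      powr_midpoint_le[of "q / 2" "(primal_norm B x)\<^sup>2" "(primal_norm B y)\<^sup>2"] q
    unfolding parallelogram by simp
qed

end

text \<open>Restrict \<open>f\<close> to the line through \<open>x\<close> and \<open>z\<close>; a
  convex function of one variable lies above its tangent at 0, here evaluated at 1.\<close>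

lemma convex_on_gradient_le:
  fixes f :: "'a::euclidean_space \<Rightarrow> real"
  assumes "convex_on UNIV f" "f differentiable (at x)"
  shows "f x + blinfun_apply (gradient f x) (z - x) \<le> f z"
proof -
  let ?D = "frechet_derivative f (at x)"
  have D: "(f has_derivative ?D) (at x)"
    using assms(2) by (simp add: frechet_derivative_works)
  have lin: "bounded_linear ?D" using D by (rule has_derivative_bounded_linear)
  let ?g = "\<lambda>s. f (x + s *\<^sub>R (z - x))"
  have "convex_on UNIV ?g"
  proof (rule convex_onI)
    fix t a b :: real assume "0 < t" "t < 1"
    moreover have "x + ((1 - t) *\<^sub>R a + t *\<^sub>R b) *\<^sub>R (z - x)
        = (1 - t) *\<^sub>R (x + a *\<^sub>R (z - x)) + t *\<^sub>R (x + b *\<^sub>R (z - x))"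
      by (simp add: algebra_simps)
    ultimately show "?g ((1 - t) *\<^sub>R a + t *\<^sub>R b) \<le> (1 - t) * ?g a + t * ?g b"
      using convex_onD[OF assms(1), of t "x + a *\<^sub>R (z - x)" "x + b *\<^sub>R (z - x)"] by simp
  qed simp
  moreover have "(?g has_field_derivative ?D (z - x)) (at 0)"
  proof -
    have "(?g has_derivative (\<lambda>s. ?D (s *\<^sub>R (z - x)))) (at 0)"
      by (rule has_derivative_compose[of "\<lambda>s. x + s *\<^sub>R (z - x)" _ 0 UNIV])
        (use D in \<open>auto intro!: derivative_eq_intros\<close>)
    then show ?thesis
      by (simp add: has_field_derivative_def linear_cmul[OF bounded_linear.linear[OF lin]]
          mult.commute[of _ "?D (z - x)"] mult_commute_abs)
  qed
  ultimately have "?g 1 - ?g 0 \<ge> ?D (z - x) * (1 - 0)"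
    by (intro convex_on_imp_above_tangent) auto
  then show ?thesis
    by (simp add: gradient_def bounded_linear_Blinfun_apply[OF lin])
qed

section \<open>The estimate sequence and the convergence rate\<close>

theorem theorem4p3:
  fixes B :: "'a::euclidean_space \<Rightarrow> ('a \<Rightarrow>\<^sub>L real)"
    and f :: "'a \<Rightarrow> real"
    and p T :: nat
    and \<nu> \<alpha> \<theta> M\<^sub>\<nu> :: real
    and x0 xstar :: 'a
    and x xp y v :: "nat \<Rightarrow> 'a"
    and M a A \<gamma> :: "nat \<Rightarrow> real"
    and \<psi> :: "nat \<Rightarrow> 'a \<Rightarrow> real"
  assumes "self_adjoint_pos_def B"
    and "p \<ge> 2"
    and "convex_on UNIV f"
    and "times_differentiable p f"
    and "is_arg_min f (\<lambda>_. True) xstar"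
    and "0 \<le> \<nu>" and "\<nu> \<le> 1"
    and "holder_const B p f \<nu> < \<infinity>"
    and "\<alpha> \<in> {\<nu>, 1}"
    and "\<theta> \<ge> 0"
    and "M\<^sub>\<nu> > 0"
    and "accelerated_tensor_method B p f \<alpha> \<theta> M\<^sub>\<nu> x0 T x xp y v M a A \<gamma> \<psi>"
  shows "\<forall>t\<in>{2..T}. f (x t) - f xstar
           \<le> 2 ^ (3 * p - 1) * M\<^sub>\<nu> * (real p + \<alpha>) powr (real p + \<alpha> - 1)
               * primal_norm B (x0 - xstar) powr (real p + \<alpha>)
             / (fact (p - 1) * (real t - 1) powr (real p + \<alpha>))"
proof -
  define q where "q = real p + \<alpha>"
  have q: "2 \<le> q" "q \<le> real p + 1"
    using assms(2,6,7,9) by (auto simp: q_def)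
  note B = assms(1)
  note [simp] = primal_norm_nonneg[OF B]
  have start: "x 0 = x0" "v 0 = x0" "A 0 = 0"
      "\<psi> 0 = (\<lambda>z. 1 / q * primal_norm B (z - x0) powr q)"
    and pos: "\<And>t. t < T \<Longrightarrow> 0 < M t" "\<And>t. t < T \<Longrightarrow> M t \<le> M\<^sub>\<nu>" "\<And>t. t < T \<Longrightarrow> 0 < a t"
    and a_eq: "\<And>t. t < T \<Longrightarrow> a t powr q =
          1 / 2 ^ (3 * p - 1) * (fact (p - 1) / M t) * (A t + a t) powr (q - 1)"
    and y_eq: "\<And>t. t < T \<Longrightarrow> y t = (1 - a t / (A t + a t)) *\<^sub>R x t + (a t / (A t + a t)) *\<^sub>R v t"
    and descent: "\<And>t. t < T \<Longrightarrow> blinfun_apply (gradient f (x (Suc t))) (y t - x (Suc t))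
          \<ge> 1 / 4 * (fact (p - 1) / M t) powr (1 / (q - 1))
              * dual_norm B (gradient f (x (Suc t))) powr (q / (q - 1))"
    and A_Suc: "\<And>t. t < T \<Longrightarrow> A (Suc t) = A t + a t"
    and \<psi>_Suc: "\<And>t. t < T \<Longrightarrow> \<psi> (Suc t) = (\<lambda>z. \<psi> t z + a t * (f (x (Suc t))
                 + blinfun_apply (gradient f (x (Suc t))) (z - x (Suc t))))"
    and v_min: "\<And>t z. t < T \<Longrightarrow> \<psi> (Suc t) (v (Suc t)) \<le> \<psi> (Suc t) z"
    using assms(12) unfolding accelerated_tensor_method_def q_def
    by (auto simp: is_arg_min_linorder)
  have "f differentiable (at z)" for z
    using assms(2,4) unfolding times_differentiable_def
    by (metis deriv_form.simps(1) list.size(3) less_le_trans pos2)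
  then have tangent: "f z + blinfun_apply (gradient f z) (w - z) \<le> f w" for z w
    by (rule convex_on_gradient_le[OF assms(3)])
  have min_v: "\<psi> t (v t) \<le> \<psi> t z" if "t \<le> T" for t z
  proof (cases t)
    \<comment> \<open>The method defines \<open>v\<close> as a minimizer only from index 1 on;
      \<open>v 0 = x0\<close> gives the value 0 of a nonnegative function.\<close>
    case 0
    then show ?thesis using q by (simp add: start primal_norm_def form_linear[OF B])
  qed (use that v_min in auto)
  have A_nonneg: "0 \<le> A t" if "t \<le> T" for t
    using that
  proof (induction t)
    case (Suc t)
    then show ?case using pos(3)[of t] A_Suc[of t] by simp
  qed (simp add: start)
  \<comment> \<open>Clarkson's inequality settles \<open>\<psi> 0\<close>; each update adds an
    affine function, which contributes equally to both sides.\<close>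
  have midpoint: "\<psi> t ((1/2) *\<^sub>R (z + w)) + 1 / q * primal_norm B ((1/2) *\<^sub>R (z - w)) powr q
      \<le> (\<psi> t z + \<psi> t w) / 2" if "t \<le> T" for t z w
    using that
  proof (induction t)
    case 0
    have "(1/2) *\<^sub>R (z + w) - x0 = (1/2) *\<^sub>R ((z - x0) + (w - x0))"
      by (simp add: algebra_simps flip: scaleR_add_left)
    then show ?case
      using primal_norm_powr_Clarkson[OF B q(1), of "z - x0" "w - x0"] q
      by (simp add: start divide_simps)
  next
    case (Suc t)
    have "(1/2) *\<^sub>R (z + w) - x (Suc t) = (1/2) *\<^sub>R ((z - x (Suc t)) + (w - x (Suc t)))"
      by (simp add: algebra_simps flip: scaleR_add_left)
    then have "blinfun_apply (gradient f (x (Suc t))) ((1/2) *\<^sub>R (z + w) - x (Suc t))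
        = (blinfun_apply (gradient f (x (Suc t))) (z - x (Suc t))
          + blinfun_apply (gradient f (x (Suc t))) (w - x (Suc t))) / 2"
      by (simp only: blinfun.scaleR_right blinfun.add_right) simp
    then show ?case using Suc by (simp add: \<psi>_Suc algebra_simps)
  qed
  have growth: "\<psi> t (v t) + 2 / q * (primal_norm B (z - v t) / 2) powr q \<le> \<psi> t z"
    if "t \<le> T" for t z
  proof -
    have "primal_norm B ((1/2) *\<^sub>R (z - v t)) = primal_norm B (z - v t) / 2"
      by (simp add: primal_norm_def form_linear[OF B] blinfun.scaleR_left blinfun.scaleR_right real_sqrt_divide)
    then have half: "\<psi> t ((1/2) *\<^sub>R (z + v t)) + 1 / q * (primal_norm B (z - v t) / 2) powr q
        \<le> (\<psi> t z + \<psi> t (v t)) / 2"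
      using midpoint[OF that, of z "v t"] by (simp only:)
    \<comment> \<open>Here \<open>c\<close> is the minimal value and \<open>m\<close> the value at
      the midpoint, so \<open>c \<le> m\<close>; doubling the midpoint inequality then isolates
      \<open>d\<close>.\<close>
    have "c + 2 * P \<le> d" if "m + P \<le> (d + c) / 2" "c \<le> m" for c d m P :: real
      using that by argo
    from this[OF half min_v[OF that]] show ?thesis by simp
  qed
  \<comment> \<open>By convexity, each linearization added to \<open>\<psi>\<close> lies below
    \<open>f\<close>.\<close>
  have upper: "\<psi> t z \<le> A t * f z + 1 / q * primal_norm B (z - x0) powr q" if "t \<le> T" for t z
    using that
  proof (induction t)
    case (Suc t)
    then have "a t * (f (x (Suc t)) + blinfun_apply (gradient f (x (Suc t))) (z - x (Suc t)))
        \<le> a t * f z"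
      using pos(3)[of t] tangent by (intro mult_left_mono) auto
    with Suc show ?case by (simp add: \<psi>_Suc A_Suc algebra_simps)
  qed (simp add: start)
  have lower: "A t * f (x t) \<le> \<psi> t (v t)" if "t \<le> T" for t
    using that
  proof (induction t)
    case 0
    then show ?case using q by (simp add: start)
  next
    case (Suc t)
    then have t: "t < T" "t \<le> T" by auto
    let ?g = "gradient f (x (Suc t))" and ?z = "v (Suc t)" and ?x = "x (Suc t)"
    let ?S = "A t + a t" and ?r = "primal_norm B (v (Suc t) - v t)"
    have S: "?S > 0" using A_nonneg[OF t(2)] pos(3)[OF t(1)] by simp
    have "?S *\<^sub>R y t = A t *\<^sub>R x t + a t *\<^sub>R v t"
      using S by (simp add: y_eq[OF t(1)] scaleR_add_right right_diff_distrib)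
    \<comment> \<open>The choice of \<open>y t\<close> merges the linearizations at
      \<open>x t\<close> and at the new \<open>v\<close> into a multiple of the descent term plus a
      term in \<open>v (Suc t) - v t\<close>.\<close>
    then have "A t *\<^sub>R (x t - ?x) + a t *\<^sub>R (?z - ?x) = ?S *\<^sub>R (y t - ?x) + a t *\<^sub>R (?z - v t)"
      by (simp add: algebra_simps)
    from arg_cong[OF this, of "blinfun_apply ?g"] have combine:
      "A t * blinfun_apply ?g (x t - ?x) + a t * blinfun_apply ?g (?z - ?x)
        = ?S * blinfun_apply ?g (y t - ?x) + a t * blinfun_apply ?g (?z - v t)"
      by (simp only: blinfun.add_right blinfun.scaleR_right real_scaleR_def)
    have "a t * (dual_norm B ?g * ?r)
        \<le> ?S * (1 / 4 * (fact (p - 1) / M t) powr (1 / (q - 1)) * dual_norm B ?g powr (q / (q - 1)))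
          + 2 / q * (?r / 2) powr q"
      using S pos(1,3)[OF t(1)] a_eq[OF t(1)] q
      by (intro estimate_sequence_young[where p = p]) (auto simp: dual_norm_eq[OF B])
    also have "\<dots> \<le> ?S * blinfun_apply ?g (y t - ?x) + 2 / q * (?r / 2) powr q"
      using S descent[OF t(1)] by simp
    finally have young: "a t * (dual_norm B ?g * ?r)
        \<le> ?S * blinfun_apply ?g (y t - ?x) + 2 / q * (?r / 2) powr q" .
    have "a t * - (dual_norm B ?g * ?r) \<le> a t * blinfun_apply ?g (?z - v t)"
      using pos(3)[OF t(1)] by (intro mult_left_mono dual_pairing_ge B) simp
    moreover have "A t * (f ?x + blinfun_apply ?g (x t - ?x)) \<le> A t * f (x t)"
      using A_nonneg[OF t(2)] tangent by (intro mult_left_mono)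
    \<comment> \<open>The induction hypothesis together with growth of \<open>\<psi> t\<close> from
      \<open>v t\<close>; the surplus power absorbs the negative part of the pairing.\<close>
    moreover have "A t * f (x t) + 2 / q * (?r / 2) powr q \<le> \<psi> t ?z"
      using growth[OF t(2), of ?z] Suc t by simp
    ultimately show ?case
      using young combine by (simp add: \<psi>_Suc[OF t(1)] A_Suc[OF t(1)] algebra_simps)
  qed
  \<comment> \<open>The coefficient in the equation for \<open>a t\<close> with \<open>M t\<close>
    replaced by its bound, hence a lower bound valid at every iteration.\<close>
  let ?C = "fact (p - 1) / (2 ^ (3 * p - 1) * M\<^sub>\<nu>)"
  let ?R = "primal_norm B (x0 - xstar)"
  have A_ge: "?C * (real t / q) powr q \<le> A t" if "t \<le> T" for t
  proof (rule powr_growth[where T = T])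
    fix t assume t: "t < T"
    have "?C * A (Suc t) powr (q - 1) \<le> fact (p - 1) / (2 ^ (3 * p - 1) * M t) * A (Suc t) powr (q - 1)"
      using pos[OF t] by (intro mult_right_mono divide_left_mono) auto
    then show "?C * A (Suc t) powr (q - 1) \<le> (A (Suc t) - A t) powr q"
      by (simp add: A_Suc[OF t] a_eq[OF t])
  qed (use q assms(11) that pos A_Suc start in auto)
  show ?thesis
  proof
    fix t assume "t \<in> {2..T}"
    then have t: "2 \<le> t" "t \<le> T" by auto
    have gap: "0 \<le> f (x t) - f xstar"
      using assms(5) by (simp add: is_arg_min_linorder)
    have "primal_norm B (xstar - x0) = ?R"
      by (simp add: primal_norm_def form_linear[OF B] blinfun.bilinear_simps)
    then have "A t * (f (x t) - f xstar) \<le> ?R powr q / q"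
      using lower[OF t(2)] min_v[OF t(2), of xstar] upper[OF t(2), of xstar]
      by (simp add: algebra_simps)
    \<comment> \<open>The growth bound is relaxed from \<open>t\<close> to \<open>t - 1\<close> to
      reach the stated rate; \<open>t \<ge> 2\<close> keeps the base positive for the final
      division.\<close>
    moreover have "?C * ((real t - 1) / q) powr q \<le> ?C * (real t / q) powr q"
      using t q assms(11) by (intro mult_left_mono powr_mono2 divide_right_mono) auto
    then have "?C * ((real t - 1) / q) powr q * (f (x t) - f xstar) \<le> A t * (f (x t) - f xstar)"
      using A_ge[OF t(2)] gap by (intro mult_right_mono) auto
    ultimately have "?C * ((real t - 1) / q) powr q * (f (x t) - f xstar) \<le> ?R powr q / q"
      by linarith
    \<comment> \<open>Splitting one \<open>q\<close> off \<open>q powr q\<close> cancels the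
      \<open>1 / q\<close> coming from \<open>\<psi> 0\<close> and leaves the exponent
      \<open>q - 1\<close> of the claim.\<close>
    moreover have "((real t - 1) / q) powr q = (real t - 1) powr q / (q powr (q - 1) * q)"
      using t q by (simp add: powr_divide powr_diff)
    ultimately have "?C * ((real t - 1) powr q / q powr (q - 1)) * (f (x t) - f xstar) / q \<le> ?R powr q / q"
      by simp
    then have "?C * ((real t - 1) powr q / q powr (q - 1)) * (f (x t) - f xstar) \<le> ?R powr q"
      using q by (simp only: divide_le_cancel)
    then have "f (x t) - f xstar \<le> 2 ^ (3 * p - 1) * M\<^sub>\<nu> * q powr (q - 1) * ?R powr q
        / (fact (p - 1) * (real t - 1) powr q)"
      using t q assms(11) by (simp add: field_simps)
    then show "f (x t) - f xstar
           \<le> 2 ^ (3 * p - 1) * M\<^sub>\<nu> * (real p + \<alpha>) powr (real p + \<alpha> - 1)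
               * primal_norm B (x0 - xstar) powr (real p + \<alpha>)
             / (fact (p - 1) * (real t - 1) powr (real p + \<alpha>))"
      unfolding q_def .
  qed
qed

end
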